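(* Let $S$ be a subring of a finite ring $R$ and let $r\in K(S,R)$. Then $\mathrm{Pr}_r(S,R)\leq \mathrm{Pr}(S,R)$, with equality if and only if $r=0$.
   Context: For elements $x,y$ of a ring $R$, $[x,y]=xy-yx$. For a subring $S$ of a finite ring $R$ and $r\in R$, $$\mathrm{Pr}_r(S,R)=\frac{|\{(x,y)\in S\times R : [x,y]=r\}|}{|S||R|},\qquad \mathrm{Pr}(S,R)=\mathrm{Pr}_0(S,R)=\frac{|\{(x,y)\in S\times R : [x,y]=0\}|}{|S||R|}.$$ $K(S,R)=\{[x,y] : x\in S,\ y\in R\}$. *)

theory Defs
  imports Complex_Main
begin

text \<open>
  Rings are associative but need not be unital (class \<open>ring\<close>), and correspondingly a subring
  is an additive subgroup closed under multiplication, with no condition on an identity element.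
\<close>

definition is_subring :: "'a::ring set \<Rightarrow> bool" where
  "is_subring S \<longleftrightarrow>
     0 \<in> S \<and> (\<forall>x\<in>S. \<forall>y\<in>S. x - y \<in> S) \<and> (\<forall>x\<in>S. \<forall>y\<in>S. x * y \<in> S)"

definition commutator :: "'a::ring \<Rightarrow> 'a \<Rightarrow> 'a" where
  "commutator x y = x * y - y * x"

definition commutators :: "'a::ring set \<Rightarrow> 'a set \<Rightarrow> 'a set" where
  "commutators S R = {commutator x y | x y. x \<in> S \<and> y \<in> R}"

definition Pr_eq :: "'a::ring \<Rightarrow> 'a set \<Rightarrow> 'a set \<Rightarrow> real" where
  "Pr_eq r S R =
     real (card {(x, y). (x, y) \<in> S \<times> R \<and> commutator x y = r}) / (real (card S) * real (card R))"

definition Pr_comm :: "'a::ring set \<Rightarrow> 'a set \<Rightarrow> real" where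
  "Pr_comm S R = Pr_eq 0 S R"

end

theory Submission
  imports Defs
begin

text \<open>
  For fixed \<open>x\<close>, the map \<open>y \<mapsto> [x, y]\<close> is additive, so its fibre over \<open>r\<close> is either empty or a
  translate of its kernel, the centralizer of \<open>x\<close>.  Counting pairs one \<open>x\<close> at a time, no \<open>x\<close> has
  more solutions of \<open>[x, y] = r\<close> than of \<open>[x, y] = 0\<close> (lemma \<open>card_commutator_fibre_le\<close>), and
  the inequality follows.  If \<open>r \<noteq> 0\<close>, the element \<open>x = 0\<close> of \<open>S\<close> makes it strict: it commutes
  with all of the ring, and so contributes nothing to the count for \<open>r\<close>.
\<close>

lemma commutator_diff_right: "commutator x (y - z) = commutator x y - commutator x z"
  by (simp add: commutator_def algebra_simps)

text \<open>Subtracting one fixed solution injects the solutions over \<open>r\<close> into the centralizer of \<open>x\<close>.\<close>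

lemma card_commutator_fibre_le:
  fixes x r :: "'a::{ring,finite}"
  shows "card {y. commutator x y = r} \<le> card {y. commutator x y = 0}"
proof (cases "\<exists>z. commutator x z = r")
  case True
  then obtain z where z: "commutator x z = r" by blast
  show ?thesis
  proof (rule card_inj_on_le)
    show "inj_on (\<lambda>y. y - z) {y. commutator x y = r}"
      by (simp add: inj_on_def)
    show "(\<lambda>y. y - z) ` {y. commutator x y = r} \<subseteq> {y. commutator x y = 0}"
      using z by (auto simp: commutator_diff_right)
  qed simp
next
  case False
  then show ?thesis by simp
qed

lemma Pr_eq_conv_sum:
  fixes S :: "'a::{ring,finite} set"
  shows "Pr_eq r S UNIV =
    real (\<Sum>x\<in>S. card {y. commutator x y = r}) / (real (card S) * real (card (UNIV :: 'a set)))"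
proof -
  have "{(x, y). (x, y) \<in> S \<times> UNIV \<and> commutator x y = r} = Sigma S (\<lambda>x. {y. commutator x y = r})"
    by auto
  then show ?thesis
    by (simp add: Pr_eq_def)
qed

lemma Pr_eq_le_Pr_comm:
  fixes S :: "'a::{ring,finite} set"
  shows "Pr_eq r S UNIV \<le> Pr_comm S UNIV"
  unfolding Pr_comm_def Pr_eq_conv_sum
  by (intro divide_right_mono of_nat_mono sum_mono card_commutator_fibre_le) simp

lemma Pr_eq_less_Pr_comm:
  fixes S :: "'a::{ring,finite} set"
  assumes "0 \<in> S" and "r \<noteq> 0"
  shows "Pr_eq r S UNIV < Pr_comm S UNIV"
proof -
  have at_zero: "card {y::'a. commutator 0 y = r} < card {y::'a. commutator 0 y = 0}"
    using \<open>r \<noteq> 0\<close> by (simp add: commutator_def finite_UNIV_card_ge_0)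
  have "(\<Sum>x\<in>S. card {y. commutator x y = r}) < (\<Sum>x\<in>S. card {y. commutator x y = 0})"
    using at_zero \<open>0 \<in> S\<close> by (intro sum_strict_mono_ex1) (auto intro: card_commutator_fibre_le)
  moreover have "0 < real (card S) * real (card (UNIV :: 'a set))"
    using \<open>0 \<in> S\<close> by (intro mult_pos_pos) (auto simp: card_gt_0_iff)
  ultimately show ?thesis
    unfolding Pr_comm_def Pr_eq_conv_sum by (intro divide_strict_right_mono) (simp_all only: of_nat_less_iff)
qed

theorem proposition3p2:
  fixes S :: "'a::{ring,finite} set" and r :: 'a
  assumes "is_subring S"
    and "r \<in> commutators S UNIV"
  shows "Pr_eq r S UNIV \<le> Pr_comm S UNIV
    \<and> (Pr_eq r S UNIV = Pr_comm S UNIV \<longleftrightarrow> r = 0)"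
proof -
  have "0 \<in> S"
    using assms(1) by (simp add: is_subring_def)
  then have "r \<noteq> 0 \<Longrightarrow> Pr_eq r S UNIV < Pr_comm S UNIV"
    by (rule Pr_eq_less_Pr_comm)
  moreover have "r = 0 \<Longrightarrow> Pr_eq r S UNIV = Pr_comm S UNIV"
    by (simp add: Pr_comm_def)
  ultimately show ?thesis
    using Pr_eq_le_Pr_comm[of r S] by (cases "r = 0") auto
qed

end
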